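(* Consider a connected grid with vertex set $\mathcal{N}=\{1,\dots,N\}$, a set $\mathcal{A}\subseteq\mathcal{N}$ of buses at which the attacker can alter power injections, and a nonempty set $\mathcal{M}\subseteq\mathcal{N}$ of PMU buses, where the line reactances are independent (not necessarily identically distributed) continuous random variables strictly bounded away from zero from below. Then whether a non-zero unobservable attack restricted to $\mathcal{A}$ exists can be determined with probability one based solely on the grid topology; that is, there is a truth value $T$, depending only on the (unweighted) graph and on $\mathcal{A}$ and $\mathcal{M}$, such that for every such choice of distributions of the reactances, with probability one, a non-zero unobservable attack restricted to $\mathcal{A}$ exists if and only if $T$ is true.
   Context: The line joining buses $n,m$ has reactance $x_{nm}>0$ and edge weight $1/x_{nm}$; $\boldsymbol{B}\in\mathbb{R}^{N\times N}$ is the Laplacian of the resulting weighted graph ($\boldsymbol{B}_{ij}=-1/x_{ij}$ for adjacent $i\neq j$, $0$ for nonadjacent $i\neq j$, and $\boldsymbol{B}_{ii}=\sum_{j}1/x_{ij}$ over neighbors $j$ of $i$). An attack $\Delta\boldsymbol{P}\in\mathbb{R}^N$, $\Delta\boldsymbol{P}\ne\boldsymbol{0}$, is unobservable by $\mathcal{M}$ if there exists $\Delta\boldsymbol{\theta}\in\mathbb{R}^N$ with $\Delta\boldsymbol{P}=\boldsymbol{B}\Delta\boldsymbol{\theta}$ and $\Delta\boldsymbol{\theta}_{\mathcal{M}}=\boldsymbol{0}$. It is restricted to $\mathcal{A}$ if $\Delta\boldsymbol{P}_{\mathcal{A}^c}=\boldsymbol{0}$, where $\mathcal{A}^c=\mathcal{N}\setminus\mathcal{A}$.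 *)

theory Defs
  imports "HOL-Probability.Probability"
begin

(* Buses are the elements of a finite type 'n, so that CARD('n) is N; a line is the two-element
   set of its end points, and a reactance vector assigns a real number to every line. *)

definition simple_graph :: "'n set set \<Rightarrow> bool" where
  "simple_graph E \<longleftrightarrow> (\<forall>e\<in>E. \<exists>u v. u \<noteq> v \<and> e = {u, v})"

definition connected_graph :: "'n set set \<Rightarrow> bool" where
  "connected_graph E \<longleftrightarrow> (\<forall>u v. (u, v) \<in> {(i, j). {i, j} \<in> E}\<^sup>*)"

definition laplacian :: "'n::finite set set \<Rightarrow> ('n set \<Rightarrow> real) \<Rightarrow> real^'n^'n" where
  "laplacian E x = (\<chi> i j.
     if i = j then (\<Sum>k | {i, k} \<in> E. 1 / x {i, k})
     else if {i, j} \<in> E then - 1 / x {i, j}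
     else 0)"

definition unobservable_attack ::
  "'n::finite set set \<Rightarrow> ('n set \<Rightarrow> real) \<Rightarrow> 'n set \<Rightarrow> real^'n \<Rightarrow> bool" where
  "unobservable_attack E x M \<Delta>P \<longleftrightarrow>
     \<Delta>P \<noteq> 0 \<and> (\<exists>\<Delta>\<theta>. \<Delta>P = laplacian E x *v \<Delta>\<theta> \<and> (\<forall>i\<in>M. \<Delta>\<theta> $ i = 0))"

definition restricted_to :: "'n::finite set \<Rightarrow> real^'n \<Rightarrow> bool" where
  "restricted_to A \<Delta>P \<longleftrightarrow> (\<forall>i\<in>- A. \<Delta>P $ i = 0)"

(* Continuous random variable: the cumulative distribution function is continuous, i.e. the law
   has no atoms. Random variables with a density are a special case. *)

definition continuous_rv :: "'w measure \<Rightarrow> ('w \<Rightarrow> real) \<Rightarrow> bool" where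
  "continuous_rv \<Omega> X \<longleftrightarrow>
     X \<in> borel_measurable \<Omega> \<and> continuous_on UNIV (cdf (distr \<Omega> borel X))"

definition random_reactances ::
  "'w measure \<Rightarrow> 'n set set \<Rightarrow> ('n set \<Rightarrow> 'w \<Rightarrow> real) \<Rightarrow> bool" where
  "random_reactances \<Omega> E X \<longleftrightarrow>
     prob_space \<Omega> \<and>
     prob_space.indep_vars \<Omega> (\<lambda>_. borel) X E \<and>
     (\<forall>e\<in>E. continuous_rv \<Omega> (X e) \<and> (\<exists>c>0. AE \<omega> in \<Omega>. c \<le> X e \<omega>))"

(* A truth value T is to serve all probability spaces at once, but a type of sample points cannot
   be quantified inside the scope of T. A claim about T is therefore made for a free type 'w and,
   with the same T, for sample points of type 'n set => real. The latter type carries every joint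
   law of the reactances (as a product measure over the lines), so it determines T, and T cannot
   vary with 'w. *)

end

theory Submission
  imports Defs
begin

text \<open>
  Because the Laplacian \<open>B\<close> of a connected graph with positive weights is injective on the vectors
  \<open>\<theta>\<close> that vanish on \<open>M \<noteq> {}\<close>, a non-zero attack is the same as a non-zero \<open>\<theta>\<close> with \<open>\<theta> = 0\<close> on
  \<open>M\<close> and \<open>B \<theta> = 0\<close> on the complement of \<open>A\<close>. This is a homogeneous linear system. Its normal
  matrix \<open>S\<close>, the sum of \<open>C\<^sup>T C\<close> with \<open>C\<close> the rows of \<open>B\<close> outside \<open>A\<close> and of the projection onto the
  coordinates in \<open>M\<close>, is square and has the same kernel, so an attack exists if and only if
  \<open>det S = 0\<close> (lemma \<open>attack_exists_iff_det\<close>).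

  The entries of \<open>S\<close>, and hence \<open>det S\<close>, are polynomials in the edge weights \<open>w = 1 / x\<close>, and which
  polynomials they are depends only on the graph, \<open>A\<close> and \<open>M\<close>. The truth value sought is therefore
  whether \<open>det S\<close> vanishes identically: if it does, there is an attack whenever the reactances are
  positive; if it does not, its zero set has probability zero, because a non-zero polynomial does
  not vanish almost surely at independent random arguments without atoms (lemma
  \<open>AE_polynomial_nonzero\<close>). The latter follows by Fubini from the fact that a non-zero polynomial
  in one variable has finitely many roots. Atomlessness passes from the reactances to the weights
  since \<open>1 / x\<close> is injective.
\<close>

section \<open>Polynomials in independent atomless random variables\<close>

text \<open>
  Polynomials are represented by the functions that they induce: closure under substituting a number
  for one variable, dependence on the coordinates in \<open>I\<close> only, and measurability are then rule
  inductions. The arguments are total functions, so \<open>I\<close> may be any subset of the index type.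
\<close>

inductive polynomial_fun :: "'a set \<Rightarrow> (('a \<Rightarrow> real) \<Rightarrow> real) \<Rightarrow> bool" for I where
  const: "polynomial_fun I (\<lambda>w. c)"
| var: "i \<in> I \<Longrightarrow> polynomial_fun I (\<lambda>w. w i)"
| add: "polynomial_fun I f \<Longrightarrow> polynomial_fun I g \<Longrightarrow> polynomial_fun I (\<lambda>w. f w + g w)"
| mult: "polynomial_fun I f \<Longrightarrow> polynomial_fun I g \<Longrightarrow> polynomial_fun I (\<lambda>w. f w * g w)"

lemma polynomial_fun_uminus:
  assumes "polynomial_fun I f"
  shows "polynomial_fun I (\<lambda>w. - f w)"
  using polynomial_fun.mult[OF polynomial_fun.const[where c = "-1"] assms] by simp

lemma polynomial_fun_sum:
  assumes "\<And>a. a \<in> S \<Longrightarrow> polynomial_fun I (f a)"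
  shows "polynomial_fun I (\<lambda>w. \<Sum>a\<in>S. f a w)"
  using assms
  by (induction S rule: infinite_finite_induct) (auto intro: polynomial_fun.intros)

lemma polynomial_fun_prod:
  assumes "\<And>a. a \<in> S \<Longrightarrow> polynomial_fun I (f a)"
  shows "polynomial_fun I (\<lambda>w. \<Prod>a\<in>S. f a w)"
  using assms
  by (induction S rule: infinite_finite_induct) (auto intro: polynomial_fun.intros)

lemma polynomial_fun_det:
  fixes C :: "('a \<Rightarrow> real) \<Rightarrow> real^'n^'n"
  assumes "\<And>i j. polynomial_fun I (\<lambda>w. C w $ i $ j)"
  shows "polynomial_fun I (\<lambda>w. det (C w))"
  unfolding det_def
  by (intro polynomial_fun_sum polynomial_fun.mult polynomial_fun.const polynomial_fun_prod assms)

lemma polynomial_fun_cong: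
  assumes "polynomial_fun I f" "\<And>i. i \<in> I \<Longrightarrow> w i = w' i"
  shows "f w = f w'"
  using assms by induction auto

lemma polynomial_fun_measurable:
  assumes "polynomial_fun I f"
  shows "f \<in> borel_measurable (Pi\<^sub>M I (\<lambda>_. borel))"
  using assms
  by induction (auto intro: borel_measurable_add borel_measurable_times measurable_component_singleton)

lemma polynomial_fun_fun_upd:
  assumes "polynomial_fun (insert i I) f"
  shows "polynomial_fun I (\<lambda>w. f (w(i := t)))"
  using assms
proof induction
  case (var j)
  then show ?case
    by (cases "j = i") (auto intro: polynomial_fun.intros)
qed (auto intro: polynomial_fun.intros)

lemma polynomial_fun_univariate:
  assumes "polynomial_fun I f"
  shows "\<exists>p. \<forall>t. f (w(i := t)) = poly p t"
  using assms
proof induction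
  case (const c)
  have "c = poly [:c:] t" for t
    by simp
  then show ?case
    by blast
next
  case (var j)
  have "(w(i := t)) j = poly (if j = i then [:0, 1:] else [:w j:]) t" for t
    by simp
  then show ?case
    by blast
next
  case (add f g)
  then obtain p q where "\<forall>t. f (w(i := t)) = poly p t" "\<forall>t. g (w(i := t)) = poly q t"
    by blast
  then have "f (w(i := t)) + g (w(i := t)) = poly (p + q) t" for t
    by simp
  then show ?case
    by blast
next
  case (mult f g)
  then obtain p q where "\<forall>t. f (w(i := t)) = poly p t" "\<forall>t. g (w(i := t)) = poly q t"
    by blast
  then have "f (w(i := t)) * g (w(i := t)) = poly (p * q) t" for t
    by simp
  then show ?case
    by blast
qed

text \<open>
  Split off one variable \<open>t\<close> of \<open>f\<close> and choose a point at which \<open>f\<close> does not vanish. Through that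
  point \<open>f\<close> is a non-zero univariate polynomial in \<open>t\<close>, so all but finitely many values of \<open>t\<close>,
  which form a set of full measure, leave a non-zero polynomial in the other variables. The
  induction hypothesis applies to these, and Fubini combines the two.
\<close>

lemma AE_PiM_polynomial_nonzero:
  fixes \<mu> :: "'a \<Rightarrow> real measure"
  assumes "finite I"
    and "polynomial_fun I f" and "f w\<^sub>0 \<noteq> 0"
    and "\<And>i. i \<in> I \<Longrightarrow> prob_space (\<mu> i)"
    and "\<And>i. i \<in> I \<Longrightarrow> sets (\<mu> i) = sets borel"
    and "\<And>i c. i \<in> I \<Longrightarrow> AE t in \<mu> i. t \<noteq> c"
  shows "AE w in Pi\<^sub>M I \<mu>. f w \<noteq> 0"
  using assms
proof (induction I arbitrary: f w\<^sub>0 rule: finite_induct)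
  case empty
  have "f w = f w\<^sub>0" for w
    using empty.prems(1) by (rule polynomial_fun_cong) simp
  then have "f w \<noteq> 0" for w
    using empty.prems(2) by metis
  then show ?case
    by simp
next
  case (insert i I)
  interpret mi: prob_space "\<mu> i"
    using insert.prems by simp
  interpret mI: prob_space "Pi\<^sub>M I \<mu>"
    using insert.prems by (intro prob_space_PiM) auto
  interpret P: pair_sigma_finite "\<mu> i" "Pi\<^sub>M I \<mu>" ..
  have meas_f: "f \<in> borel_measurable (Pi\<^sub>M (insert i I) \<mu>)"
  proof -
    have "sets (Pi\<^sub>M (insert i I) \<mu>) = sets (Pi\<^sub>M (insert i I) (\<lambda>_. borel))"
      using insert.prems by (intro sets_PiM_cong) auto
    then show ?thesis
      using polynomial_fun_measurable[OF insert.prems(1)] by (simp cong: measurable_cong_sets)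
  qed
  have upd: "(\<lambda>(t, w). w(i := t)) \<in> \<mu> i \<Otimes>\<^sub>M Pi\<^sub>M I \<mu> \<rightarrow>\<^sub>M Pi\<^sub>M (insert i I) \<mu>"
    unfolding split_beta' by (rule measurable_fun_upd[where J = I]) auto
  obtain p where p: "\<And>t. f (w\<^sub>0(i := t)) = poly p t"
    using polynomial_fun_univariate[OF insert.prems(1)] by metis
  have "p \<noteq> 0"
    using p[of "w\<^sub>0 i"] insert.prems(2) by auto
  then have "finite {t. poly p t = 0}"
    by (rule poly_roots_finite)
  then have "AE t in \<mu> i. \<forall>c\<in>{t. poly p t = 0}. t \<noteq> c"
    using insert.prems by (intro AE_finite_allI) auto
  then have "AE t in \<mu> i. AE w in Pi\<^sub>M I \<mu>. f (w(i := t)) \<noteq> 0"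
  proof eventually_elim
    case (elim t)
    then have "f (w\<^sub>0(i := t)) \<noteq> 0"
      using p by auto
    then show ?case
      by (rule insert.IH[OF polynomial_fun_fun_upd[OF insert.prems(1)]]) (use insert.prems in auto)
  qed
  then have "AE z in \<mu> i \<Otimes>\<^sub>M Pi\<^sub>M I \<mu>. f ((\<lambda>(t, w). w(i := t)) z) \<noteq> 0"
    using upd meas_f by (intro P.AE_pair_measure) auto
  then have "AE w in distr (\<mu> i \<Otimes>\<^sub>M Pi\<^sub>M I \<mu>) (Pi\<^sub>M (insert i I) \<mu>) (\<lambda>(t, w). w(i := t)). f w \<noteq> 0"
    using upd meas_f by (simp add: AE_distr_iff)
  then show ?case
    using insert.prems by (subst (asm) distr_pair_PiM_eq_PiM) auto
qed

lemma (in prob_space) AE_polynomial_nonzero: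
  fixes Y :: "'i \<Rightarrow> 'a \<Rightarrow> real"
  assumes "finite I" and indep: "indep_vars (\<lambda>_. borel) Y I"
    and noatom: "\<And>i c. i \<in> I \<Longrightarrow> AE \<omega> in M. Y i \<omega> \<noteq> c"
    and poly: "polynomial_fun I f" and nz: "f w\<^sub>0 \<noteq> 0"
  shows "AE \<omega> in M. f (\<lambda>i. Y i \<omega>) \<noteq> 0"
proof (cases "I = {}")
  \<comment> \<open>The description of independence by a product law presupposes a non-empty index set.\<close>
  case True
  have "f w = f w\<^sub>0" for w
    using poly by (rule polynomial_fun_cong) (simp add: True)
  then have "f w \<noteq> 0" for w
    using nz by metis
  then show ?thesis
    by simp
next
  case False
  have rv [measurable]: "random_variable borel (Y i)" if "i \<in> I" for i
    using indep that by (simp add: indep_vars_def)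
  have [measurable]: "f \<in> borel_measurable (Pi\<^sub>M I (\<lambda>_. borel))"
    using poly by (rule polynomial_fun_measurable)
  have [measurable]: "(\<lambda>\<omega>. \<lambda>i\<in>I. Y i \<omega>) \<in> M \<rightarrow>\<^sub>M Pi\<^sub>M I (\<lambda>_. borel)"
    by (rule measurable_restrict) (rule rv)
  have "AE w in Pi\<^sub>M I (\<lambda>i. distr M borel (Y i)). f w \<noteq> 0"
    using assms rv
    by (intro AE_PiM_polynomial_nonzero prob_space_distr) (auto simp: AE_distr_iff)
  then have "AE w in distr M (Pi\<^sub>M I (\<lambda>_. borel)) (\<lambda>\<omega>. \<lambda>i\<in>I. Y i \<omega>). f w \<noteq> 0"
    by (subst indep_vars_iff_distr_eq_PiM'[THEN iffD1, OF False rv indep])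
  then have "AE \<omega> in M. f (\<lambda>i\<in>I. Y i \<omega>) \<noteq> 0"
    by (simp add: AE_distr_iff)
  moreover have "f (\<lambda>i\<in>I. Y i \<omega>) = f (\<lambda>i. Y i \<omega>)" for \<omega>
    using poly by (rule polynomial_fun_cong) simp
  ultimately show ?thesis
    by simp
qed

lemma (in prob_space) continuous_rv_AE_neq:
  assumes "continuous_rv M X"
  shows "AE \<omega> in M. X \<omega> \<noteq> c"
proof -
  have X [measurable]: "random_variable borel X"
    and cont: "continuous_on UNIV (cdf (distr M borel X))"
    using assms by (auto simp: continuous_rv_def)
  interpret X: prob_space "distr M borel X"
    by (rule prob_space_distr) measurable
  interpret finite_borel_measure "distr M borel X"
    by unfold_locales simp
  have "isCont (cdf (distr M borel X)) c"
    using cont by (simp add: continuous_on_eq_continuous_at)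
  then have "measure (distr M borel X) {c} = 0"
    by (simp add: isCont_cdf)
  then have "AE x in distr M borel X. x \<notin> {c}"
    by (intro AE_not_in) (simp add: null_sets_def X.emeasure_eq_measure)
  then show ?thesis
    by (simp add: AE_distr_iff)
qed

section \<open>The grounded Laplacian of a connected graph\<close>

lemma simple_graph_no_loop:
  assumes "simple_graph E"
  shows "{i, i} \<notin> E"
  using assms by (fastforce simp: simple_graph_def doubleton_eq_iff)

lemma laplacian_mult_component:
  fixes E :: "'n::finite set set"
  assumes "simple_graph E"
  shows "(laplacian E x *v \<theta>) $ i = (\<Sum>k | {i, k} \<in> E. (\<theta> $ i - \<theta> $ k) / x {i, k})"
proof -
  have entry: "laplacian E x $ i $ j * \<theta> $ j =
      (if j = i then (\<Sum>k | {i, k} \<in> E. 1 / x {i, k}) * \<theta> $ i else 0)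
      - (if {i, j} \<in> E then \<theta> $ j / x {i, j} else 0)" for j
    using simple_graph_no_loop[OF assms, of i] by (auto simp: laplacian_def)
  have "(laplacian E x *v \<theta>) $ i =
      (\<Sum>k | {i, k} \<in> E. 1 / x {i, k}) * \<theta> $ i - (\<Sum>k | {i, k} \<in> E. \<theta> $ k / x {i, k})"
    by (simp add: matrix_vector_mult_def entry sum_subtractf sum.If_cases)
  then show ?thesis
    by (simp add: sum_distrib_right sum_subtractf diff_divide_distrib)
qed

text \<open>
  This is the maximum principle: at a vertex where \<open>\<theta>\<close> is maximal all summands of
  \<open>(B \<theta>) $ i = \<Sum>\<^sub>k (\<theta> $ i - \<theta> $ k) / x {i, k}\<close> are non-negative, so that they all vanish if the sum
  does. The maximum thus spreads to all neighbours, and by connectedness to \<open>m\<close>, where \<open>\<theta>\<close> is zero.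
\<close>

lemma grounded_laplacian_injective:
  fixes E :: "'n::finite set set"
  assumes simple: "simple_graph E" and conn: "connected_graph E"
    and pos: "\<And>e. e \<in> E \<Longrightarrow> 0 < x e"
    and ground: "m \<in> M" "\<forall>i\<in>M. \<theta> $ i = 0"
    and kernel: "laplacian E x *v \<theta> = 0"
  shows "\<theta> = 0"
proof -
  obtain r where r: "\<And>j. \<theta> $ j \<le> \<theta> $ r"
  proof -
    have "Max (range (($) \<theta>)) \<in> range (($) \<theta>)"
      by (intro Max_in) auto
    then obtain r where "Max (range (($) \<theta>)) = \<theta> $ r"
      by (rule rangeE)
    then have "\<theta> $ j \<le> \<theta> $ r" for j
      by (metis Max_ge finite finite_imageI rangeI)
    then show ?thesis
      by (rule that)
  qed
  have const: "\<theta> $ j = \<theta> $ r" for j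
  proof -
    have "(r, j) \<in> {(i, j). {i, j} \<in> E}\<^sup>*"
      using conn by (simp add: connected_graph_def)
    then show ?thesis
    proof (induction rule: rtrancl_induct)
      case (step i k)
      have "(\<Sum>k | {i, k} \<in> E. (\<theta> $ i - \<theta> $ k) / x {i, k}) = 0"
        using kernel laplacian_mult_component[OF simple, of x \<theta> i] by simp
      moreover have "0 \<le> (\<theta> $ i - \<theta> $ k) / x {i, k}" if "{i, k} \<in> E" for k
        using r[of k] step.IH pos[OF that] by simp
      ultimately have "(\<theta> $ i - \<theta> $ k) / x {i, k} = 0"
        using step.hyps(2) by (subst (asm) sum_nonneg_eq_0_iff) auto
      then show ?case
        using step.hyps(2) step.IH pos[of "{i, k}"] by auto
    qed simp
  qed
  have "\<theta> $ j = 0" for j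
    using const[of j] const[of m] ground by simp
  then show ?thesis
    by (simp add: vec_eq_iff)
qed

section \<open>Attacks as zeros of a polynomial in the edge weights\<close>

text \<open>
  This is \<open>B\<^sup>T D B + D'\<close>, where \<open>D\<close> and \<open>D'\<close> are the diagonal 0-1 matrices of \<open>- A\<close> and \<open>M\<close>. Passing
  to it from the block of \<open>B\<close> with rows in \<open>- A\<close> and columns in \<open>- M\<close> replaces the simultaneous
  vanishing of all maximal minors of a rectangular matrix by that of one determinant.
\<close>

definition attack_matrix :: "real^'n^'n \<Rightarrow> 'n set \<Rightarrow> 'n set \<Rightarrow> real^'n^'n" where
  "attack_matrix B A M =
     (\<chi> i j. (\<Sum>k\<in>- A. B $ k $ i * B $ k $ j) + (if i = j \<and> i \<in> M then 1 else 0))"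

lemma attack_matrix_mult:
  "(attack_matrix B A M *v \<theta>) $ i =
     (\<Sum>k\<in>- A. B $ k $ i * (B *v \<theta>) $ k) + (if i \<in> M then \<theta> $ i else 0)"
proof -
  have "(attack_matrix B A M *v \<theta>) $ i =
      (\<Sum>j\<in>UNIV. \<Sum>k\<in>- A. B $ k $ i * (B $ k $ j * \<theta> $ j)) +
      (\<Sum>j\<in>UNIV. if i = j then (if i \<in> M then \<theta> $ i else 0) else 0)"
    unfolding sum.distrib[symmetric]
    by (auto simp: matrix_vector_mult_def attack_matrix_def algebra_simps sum_distrib_left
        intro!: sum.cong)
  also have "(\<Sum>j\<in>UNIV. \<Sum>k\<in>- A. B $ k $ i * (B $ k $ j * \<theta> $ j)) =
      (\<Sum>k\<in>- A. B $ k $ i * (B *v \<theta>) $ k)"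
    by (subst sum.swap) (simp add: matrix_vector_mult_def sum_distrib_left)
  finally show ?thesis
    by simp
qed

lemma attack_matrix_quadratic_form:
  "\<theta> \<bullet> (attack_matrix B A M *v \<theta>) = (\<Sum>k\<in>- A. ((B *v \<theta>) $ k)\<^sup>2) + (\<Sum>i\<in>M. (\<theta> $ i)\<^sup>2)"
proof -
  have "\<theta> \<bullet> (attack_matrix B A M *v \<theta>) =
      (\<Sum>i\<in>UNIV. \<Sum>k\<in>- A. (B *v \<theta>) $ k * (B $ k $ i * \<theta> $ i)) +
      (\<Sum>i\<in>UNIV. if i \<in> M then (\<theta> $ i)\<^sup>2 else 0)"
    unfolding sum.distrib[symmetric]
    by (auto simp: inner_vec_def attack_matrix_mult algebra_simps sum_distrib_left power2_eq_square
        intro!: sum.cong)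
  also have "(\<Sum>i\<in>UNIV. \<Sum>k\<in>- A. (B *v \<theta>) $ k * (B $ k $ i * \<theta> $ i)) =
      (\<Sum>k\<in>- A. ((B *v \<theta>) $ k)\<^sup>2)"
    by (subst sum.swap) (simp add: matrix_vector_mult_def sum_distrib_left power2_eq_square)
  also have "(\<Sum>i\<in>UNIV. if i \<in> M then (\<theta> $ i)\<^sup>2 else 0) = (\<Sum>i\<in>M. (\<theta> $ i)\<^sup>2)"
    by (simp add: sum.If_cases)
  finally show ?thesis .
qed

text \<open>
  The quadratic form of the matrix is a sum of squares of the left-hand sides of the system, so a
  vector in its kernel solves every equation of the system.
\<close>

lemma det_attack_matrix_eq_0_iff:
  "det (attack_matrix B A M) = 0 \<longleftrightarrow>
     (\<exists>\<theta>. \<theta> \<noteq> 0 \<and> (\<forall>k\<in>- A. (B *v \<theta>) $ k = 0) \<and> (\<forall>i\<in>M. \<theta> $ i = 0))"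
proof -
  have "attack_matrix B A M *v \<theta> = 0 \<longleftrightarrow>
      (\<forall>k\<in>- A. (B *v \<theta>) $ k = 0) \<and> (\<forall>i\<in>M. \<theta> $ i = 0)" for \<theta>
  proof
    assume "attack_matrix B A M *v \<theta> = 0"
    then have "(\<Sum>k\<in>- A. ((B *v \<theta>) $ k)\<^sup>2) + (\<Sum>i\<in>M. (\<theta> $ i)\<^sup>2) = 0"
      by (simp flip: attack_matrix_quadratic_form)
    then show "(\<forall>k\<in>- A. (B *v \<theta>) $ k = 0) \<and> (\<forall>i\<in>M. \<theta> $ i = 0)"
      by (simp add: add_nonneg_eq_0_iff sum_nonneg sum_nonneg_eq_0_iff)
  qed (simp add: vec_eq_iff attack_matrix_mult)
  moreover have "det (attack_matrix B A M) = 0 \<longleftrightarrow>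
      (\<exists>\<theta>. \<theta> \<noteq> 0 \<and> attack_matrix B A M *v \<theta> = 0)"
    by (metis invertible_det_nz invertible_left_inverse matrix_left_invertible_ker)
  ultimately show ?thesis
    by auto
qed

text \<open>
  An attack is required to satisfy \<open>\<Delta>P \<noteq> 0\<close>, the determinant speaks of \<open>\<theta> \<noteq> 0\<close>; injectivity of the
  grounded Laplacian makes the two agree.
\<close>

lemma attack_exists_iff_det:
  fixes E :: "'n::finite set set"
  assumes "simple_graph E" and "connected_graph E" and "M \<noteq> {}"
    and "\<And>e. e \<in> E \<Longrightarrow> 0 < x e"
  shows "(\<exists>\<Delta>P. unobservable_attack E x M \<Delta>P \<and> restricted_to A \<Delta>P) \<longleftrightarrow>
    det (attack_matrix (laplacian E x) A M) = 0"
proof -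
  obtain m where "m \<in> M"
    using \<open>M \<noteq> {}\<close> by blast
  then have "laplacian E x *v \<theta> \<noteq> 0 \<longleftrightarrow> \<theta> \<noteq> 0" if "\<forall>i\<in>M. \<theta> $ i = 0" for \<theta>
    using grounded_laplacian_injective[OF assms(1,2), of x m M \<theta>] assms(4) that by auto
  then show ?thesis
    unfolding det_attack_matrix_eq_0_iff unobservable_attack_def restricted_to_def by blast
qed

text \<open>
  The reactances are written as reciprocals of the weights \<open>w\<close>. Since \<open>1 / (1 / t) = t\<close> holds for
  every real \<open>t\<close>, including \<open>0\<close> by the convention \<open>1 / 0 = 0\<close>, the Laplacian is linear in \<open>w\<close> without
  restriction on \<open>w\<close>.
\<close>

lemma polynomial_fun_det_attack_matrix:
  fixes E :: "'n::finite set set"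
  shows "polynomial_fun E (\<lambda>w. det (attack_matrix (laplacian E (\<lambda>e. 1 / w e)) A M))"
proof -
  have "polynomial_fun E (\<lambda>w. laplacian E (\<lambda>e. 1 / w e) $ i $ j)" for i j
    by (cases "i = j"; cases "{i, j} \<in> E")
      (auto simp: laplacian_def
        intro!: polynomial_fun_sum polynomial_fun_uminus polynomial_fun.var polynomial_fun.const)
  then show ?thesis
    by (auto simp: attack_matrix_def
        intro!: polynomial_fun_det polynomial_fun.add polynomial_fun_sum polynomial_fun.mult
          polynomial_fun.const)
qed

section \<open>Topology decides almost surely\<close>

text \<open>
  The right-hand side of the equivalence mentions neither \<open>\<Omega>\<close> nor \<open>X\<close>, so it is one truth value for
  all probability spaces, whatever their type of sample points.
\<close>

lemma AE_attack_exists_iff: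
  fixes E :: "'n::finite set set"
  assumes graph: "simple_graph E" "connected_graph E" "M \<noteq> {}"
    and X: "random_reactances \<Omega> E X"
  shows "AE \<omega> in \<Omega>.
    (\<exists>\<Delta>P. unobservable_attack E (\<lambda>e. X e \<omega>) M \<Delta>P \<and> restricted_to A \<Delta>P) \<longleftrightarrow>
    (\<forall>w. det (attack_matrix (laplacian E (\<lambda>e. 1 / w e)) A M) = 0)"
proof -
  interpret prob_space \<Omega>
    using X by (simp add: random_reactances_def)
  define f where "f = (\<lambda>w. det (attack_matrix (laplacian E (\<lambda>e. 1 / w e)) A M))"
  have "AE \<omega> in \<Omega>. 0 < X e \<omega>" if e: "e \<in> E" for e
  proof -
    obtain c where "c > 0" "AE \<omega> in \<Omega>. c \<le> X e \<omega>"
      using X e by (auto simp: random_reactances_def)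
    then show ?thesis
      by (auto elim: eventually_mono)
  qed
  then have "AE \<omega> in \<Omega>. \<forall>e\<in>E. 0 < X e \<omega>"
    by (intro AE_finite_allI) auto
  then have attack_iff: "AE \<omega> in \<Omega>.
      (\<exists>\<Delta>P. unobservable_attack E (\<lambda>e. X e \<omega>) M \<Delta>P \<and> restricted_to A \<Delta>P) \<longleftrightarrow>
      f (\<lambda>e. 1 / X e \<omega>) = 0"
    by eventually_elim (simp add: f_def attack_exists_iff_det[OF graph])
  have "polynomial_fun E f"
    unfolding f_def by (rule polynomial_fun_det_attack_matrix)
  have "AE \<omega> in \<Omega>. f (\<lambda>e. 1 / X e \<omega>) = 0 \<longleftrightarrow> (\<forall>w. f w = 0)"
  proof (cases "\<forall>w. f w = 0")
    case True
    then show ?thesis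
      by simp
  next
    case False
    then obtain w\<^sub>0 where w0: "f w\<^sub>0 \<noteq> 0"
      by blast
    have "indep_vars (\<lambda>_. borel) (\<lambda>e \<omega>. 1 / X e \<omega>) E"
      using X by (intro indep_vars_compose2[where Y = "\<lambda>_ t. 1 / t" and M' = "\<lambda>_. borel"])
        (auto simp: random_reactances_def)
    moreover have "AE \<omega> in \<Omega>. 1 / X e \<omega> \<noteq> c" if "e \<in> E" for e c
    proof -
      have "AE \<omega> in \<Omega>. X e \<omega> \<noteq> 1 / c"
        using X that by (intro continuous_rv_AE_neq) (simp add: random_reactances_def)
      then show ?thesis
        by eventually_elim auto
    qed
    ultimately have "AE \<omega> in \<Omega>. f (\<lambda>e. 1 / X e \<omega>) \<noteq> 0"
      using w0 \<open>polynomial_fun E f\<close>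
      by (intro AE_polynomial_nonzero[where I = E]) auto
    then show ?thesis
      by eventually_elim (use False in simp)
  qed
  with attack_iff show ?thesis
    unfolding f_def by eventually_elim (rule trans)
qed

theorem corollary1:
  fixes E :: "'n::finite set set" and A M :: "'n set"
  assumes "simple_graph E" and "connected_graph E" and "M \<noteq> {}"
  shows "\<exists>T::bool.
    (\<forall>(\<Omega> :: 'w measure) X. random_reactances \<Omega> E X \<longrightarrow>
       (AE \<omega> in \<Omega>.
          (\<exists>\<Delta>P. unobservable_attack E (\<lambda>e. X e \<omega>) M \<Delta>P \<and> restricted_to A \<Delta>P) \<longleftrightarrow> T)) \<and>
    (\<forall>(\<Omega> :: ('n set \<Rightarrow> real) measure) X. random_reactances \<Omega> E X \<longrightarrow>
       (AE \<omega> in \<Omega>.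
          (\<exists>\<Delta>P. unobservable_attack E (\<lambda>e. X e \<omega>) M \<Delta>P \<and> restricted_to A \<Delta>P) \<longleftrightarrow> T))"
  by (intro exI conjI allI impI; rule AE_attack_exists_iff[OF assms])

end
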